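(* Let $$p_{G_4}(x_1,x_2,x_3,x_4)=x_3^2x_4^2+4(x_1x_2x_3+x_1x_2x_4+x_1x_3x_4+x_2x_3x_4)(x_1+x_2+x_3+x_4).$$ Then $p_{G_4}$ is hyperbolic with respect to $e=(0,0,1,1)$, and $u=(0,0,0,1)\in\Lambda_+(p_{G_4},e)$, and yet $B_{p_{G_4},e}(x)[u]$ is not a matrix sum of squares.
   Context: A homogeneous polynomial $p\in\mathbb{R}[x_1,\ldots,x_n]$ of degree $d$ is hyperbolic with respect to $e\in\mathbb{R}^n$ if $p(e)>0$ and for every $x\in\mathbb{R}^n$ the polynomial $t\mapsto p(x+te)$ has only real zeros. The hyperbolicity cone $\Lambda_+(p,e)$ is the set of $x\in\mathbb{R}^n$ such that all zeros of $t\mapsto p(te-x)$ are nonnegative. For $x,u\in\mathbb{R}^n$ put $p_x(t)=p(x+te)$ and $D_up_x(t)=(D_up)(x+te)$, with $D_u$ the directional derivative. The parameterized Bézoutian $B_{p,e}(x)[u]$ is the $d\times d$ symmetric matrix (with entries polynomial in $x$) defined by $$\frac{p_x(t)\,D_up_x(s)-D_up_x(t)\,p_x(s)}{t-s}=\sum_{i,j=1}^d [B_{p,e}(x)[u]]_{ij}\,t^{i-1}s^{j-1}.$$ A symmetric matrix $P(x)$ with polynomial entries is a matrix sum of squares if $P(x)=Q(x)Q(x)^T$ for some (possibly rectangular) matrix $Q$ with real polynomial entries. *)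

theory Defs
  imports "HOL-Analysis.Analysis" "HOL-Library.Poly_Mapping" "Jordan_Normal_Form.Matrix"
begin

(* Real polynomials in finitely many variables indexed by a finite type: an element of
   ('n =>0 nat) is an exponent vector, and the ring structure is that of Poly_Mapping
   (the monoid algebra). *)
type_synonym 'n rpoly = "('n \<Rightarrow>\<^sub>0 nat) \<Rightarrow>\<^sub>0 real"

definition Var :: "'n \<Rightarrow> 'n rpoly" where
  "Var i = Poly_Mapping.single (Poly_Mapping.single i 1) 1"

(* The value may be taken in any commutative real algebra; it is used with real and with
   complex arguments. *)
definition eval_rpoly :: "'n::finite rpoly \<Rightarrow> 'a::{comm_ring_1, real_algebra_1} ^ 'n \<Rightarrow> 'a" where
  "eval_rpoly p a =
     (\<Sum>m\<in>Poly_Mapping.keys p.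
        of_real (Poly_Mapping.lookup p m) * (\<Prod>i\<in>UNIV. (a $ i) ^ Poly_Mapping.lookup m i))"

definition mono_degree :: "('n::finite \<Rightarrow>\<^sub>0 nat) \<Rightarrow> nat" where
  "mono_degree m = (\<Sum>i\<in>UNIV. Poly_Mapping.lookup m i)"

definition total_degree :: "'n::finite rpoly \<Rightarrow> nat" where
  "total_degree p = Max (insert 0 (mono_degree ` Poly_Mapping.keys p))"

definition homogeneous :: "'n::finite rpoly \<Rightarrow> bool" where
  "homogeneous p \<longleftrightarrow> (\<forall>m\<in>Poly_Mapping.keys p. mono_degree m = total_degree p)"

definition cvec :: "real ^ 'n \<Rightarrow> complex ^ 'n" where
  "cvec x = (\<chi> i. complex_of_real (x $ i))"

definition hyperbolic :: "'n::finite rpoly \<Rightarrow> real ^ 'n \<Rightarrow> bool" where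
  "hyperbolic p e \<longleftrightarrow>
     homogeneous p \<and> eval_rpoly p e > 0 \<and>
     (\<forall>(x :: real ^ 'n) (z :: complex). eval_rpoly p (cvec x + z *s cvec e) = 0 \<longrightarrow> z \<in> \<real>)"

definition hyperbolicity_cone :: "'n::finite rpoly \<Rightarrow> real ^ 'n \<Rightarrow> (real ^ 'n) set" where
  "hyperbolicity_cone p e =
     {x. \<forall>z :: complex. eval_rpoly p (z *s cvec e - cvec x) = 0 \<longrightarrow> z \<in> \<real> \<and> Re z \<ge> 0}"

(* D_u p as a function on R^n *)
definition dir_deriv :: "real ^ 'n \<Rightarrow> 'n::finite rpoly \<Rightarrow> real ^ 'n \<Rightarrow> real" where
  "dir_deriv u p x = deriv (\<lambda>h. eval_rpoly p (x + h *\<^sub>R u)) 0"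

(* Rows and columns are numbered from 0, so entry (i, j) belongs to t^i s^j.  The entries are
   polynomials in x.  The defining identity is stated as an identity of real functions; over
   the infinite field of reals this is the same as the identity of polynomials in x, t, s,
   and it determines the matrix. *)
definition bezoutian :: "'n::finite rpoly \<Rightarrow> real ^ 'n \<Rightarrow> real ^ 'n \<Rightarrow> 'n rpoly mat" where
  "bezoutian p e u =
     (THE B. B \<in> carrier_mat (total_degree p) (total_degree p) \<and>
        (\<forall>(x :: real ^ 'n) (t :: real) (s :: real). t \<noteq> s \<longrightarrow>
           (eval_rpoly p (x + t *\<^sub>R e) * dir_deriv u p (x + s *\<^sub>R e)
             - dir_deriv u p (x + t *\<^sub>R e) * eval_rpoly p (x + s *\<^sub>R e)) / (t - s)
           = (\<Sum>i<total_degree p. \<Sum>j<total_degree p. eval_rpoly (B $$ (i, j)) x * t ^ i * s ^ j)))"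

definition matrix_sos :: "'n rpoly mat \<Rightarrow> bool" where
  "matrix_sos P \<longleftrightarrow> (\<exists>m. \<exists>Q \<in> carrier_mat (dim_row P) m. P = Q * transpose_mat Q)"

definition p_G4 :: "4 rpoly" where
  "p_G4 =
     Var 3 ^ 2 * Var 4 ^ 2
     + 4 * (Var 1 * Var 2 * Var 3 + Var 1 * Var 2 * Var 4 + Var 1 * Var 3 * Var 4
            + Var 2 * Var 3 * Var 4)
         * (Var 1 + Var 2 + Var 3 + Var 4)"

end

theory Submission
  imports Defs
begin

text \<open>
  Hyperbolicity. Write \<open>P = x\<^sub>1 + x\<^sub>2\<close> and \<open>N = x\<^sub>1 x\<^sub>2\<close>, so that \<open>4 N \<le> P\<^sup>2\<close>. Centring the line
  \<open>x + t e\<close> turns the last two coordinates into \<open>t + k\<close> and \<open>t - k\<close>, and the restriction of the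
  polynomial becomes a monic quartic in \<open>t\<close> with parameters \<open>P, N, k\<close>. In every range of the
  parameters there are points \<open>\<alpha> < \<beta> < \<gamma>\<close> at which the quartic is \<open>\<le> 0\<close>, \<open>\<ge> 0\<close>, \<open>\<le> 0\<close>,
  apart from the trivial case \<open>P = k = 0\<close>; a monic quartic with such points has only real roots
  (\<open>quartic_roots_real\<close>). Membership in the cone holds because the polynomial at \<open>z e - u\<close> is
  \<open>z\<^sup>2 (z - 1)\<^sup>2\<close>.

  The Bezoutian is not a sum of squares. If it were \<open>Q Q\<^sup>T\<close>, its upper left entry, a sextic form,
  would be the sum of the squares of the entries \<open>q\<^sub>k\<close> of the first row of \<open>Q\<close>. The Newton polytope
  of the sextic (\<open>weight_le_of_sum_squares\<close>) restricts the \<open>q\<^sub>k\<close> to eleven cubic monomials. To each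
  of these belongs the vector of its coefficients in all the \<open>q\<^sub>k\<close>, and the coefficients of the
  sextic are sums of inner products of these vectors. Three edges of the Newton polytope carry
  perfect squares, which identifies three pairs of vectors. From the coefficients of the
  sextic one then computes \<open>324 |v|\<^sup>2 + |w|\<^sup>2 = - 352\<close> for two explicit linear combinations \<open>v\<close> and \<open>w\<close> of the
  vectors, which is absurd (\<open>bez_corner_not_sum_squares\<close>).

  The Bezoutian is characterised by values at real points only. To compute its entry as a
  polynomial, one needs that a real polynomial vanishing at all points is zero (\<open>rpoly_eq_0I\<close>).
\<close>

section \<open>Real-rooted cubics and quartics\<close>

lemma quadratic_roots_real:
  fixes b c \<alpha> :: real and z :: complex
  assumes "\<alpha>\<^sup>2 + b * \<alpha> + c \<le> 0"
    and "z\<^sup>2 + of_real b * z + of_real c = 0"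
  shows "z \<in> \<real>"
proof (rule ccontr)
  assume "z \<notin> \<real>"
  then have im: "Im z \<noteq> 0"
    by (simp add: complex_is_Real_iff)
  have re_eq: "(Re z)\<^sup>2 - (Im z)\<^sup>2 + b * Re z + c = 0"
    using arg_cong[OF assms(2), of Re] by (simp add: power2_eq_square)
  have "Im z * (2 * Re z + b) = 0"
    using arg_cong[OF assms(2), of Im] by (simp add: power2_eq_square algebra_simps)
  with im have b: "b = - 2 * Re z"
    by simp
  have "(\<alpha> - Re z)\<^sup>2 + (Im z)\<^sup>2 = \<alpha>\<^sup>2 + b * \<alpha> + c"
    using re_eq unfolding b by (simp add: power2_eq_square algebra_simps)
  with assms(1) have "(\<alpha> - Re z)\<^sup>2 + (Im z)\<^sup>2 \<le> 0"
    by simp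
  with im show False
    by (metis add_nonneg_pos not_le zero_le_power2 zero_less_power2)
qed

text \<open>
  The sign hypotheses here and in the quartic case are weak, so that sample points which
  happen to be roots need no separate treatment. Splitting off one root between the
  sample points always leaves a factor of the same kind in one degree less.
\<close>

lemma cubic_roots_real:
  fixes b c d \<alpha> \<beta> :: real and z :: complex
  assumes "\<alpha> < \<beta>"
    and "\<alpha>^3 + b * \<alpha>\<^sup>2 + c * \<alpha> + d \<ge> 0"
    and "\<beta>^3 + b * \<beta>\<^sup>2 + c * \<beta> + d \<le> 0"
    and z: "z^3 + of_real b * z\<^sup>2 + of_real c * z + of_real d = 0"
  shows "z \<in> \<real>"
proof -
  define f where "f t = t^3 + b * t\<^sup>2 + c * t + d" for t :: real
  have "continuous_on {\<alpha>..\<beta>} f"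
    unfolding f_def by (intro continuous_intros)
  then obtain r where r: "\<alpha> \<le> r" "r \<le> \<beta>" "f r = 0"
    using IVT2'[of f \<beta> 0 \<alpha>] assms unfolding f_def by auto
  define h where "h t = t\<^sup>2 + (b + r) * t + (c + r * (b + r))" for t :: real
  have d: "d = - (r^3 + b * r\<^sup>2 + c * r)"
    using r(3) unfolding f_def by linarith
  have fact: "f t = (t - r) * h t" for t
    unfolding f_def h_def d by (simp add: power2_eq_square power3_eq_cube algebra_simps)
  have "\<exists>t. h t \<le> 0"
  proof (cases "r = \<alpha>")
    case True
    then have "h \<beta> \<le> 0"
      using assms(1,3) fact[of \<beta>] unfolding f_def by (simp add: mult_le_0_iff)
    then show ?thesis ..
  next
    case False
    then have "h \<alpha> \<le> 0"
      using assms(2) r fact[of \<alpha>] unfolding f_def by (simp add: zero_le_mult_iff)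
    then show ?thesis ..
  qed
  then obtain t where t: "t\<^sup>2 + (b + r) * t + (c + r * (b + r)) \<le> 0"
    unfolding h_def ..
  have "z^3 + of_real b * z\<^sup>2 + of_real c * z + of_real d
      = (z - of_real r) * (z\<^sup>2 + of_real (b + r) * z + of_real (c + r * (b + r)))"
    unfolding d by (simp add: power2_eq_square power3_eq_cube algebra_simps)
  with z have "z = of_real r \<or> z\<^sup>2 + of_real (b + r) * z + of_real (c + r * (b + r)) = 0"
    by (metis mult_eq_0_iff right_minus_eq)
  with quadratic_roots_real[OF t] show ?thesis
    by auto
qed

lemma quartic_roots_real:
  fixes b c d e \<alpha> \<beta> \<gamma> :: real and z :: complex
  assumes "\<alpha> < \<beta>" "\<beta> < \<gamma>"
    and "\<alpha>^4 + b * \<alpha>^3 + c * \<alpha>\<^sup>2 + d * \<alpha> + e \<le> 0"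
    and "\<beta>^4 + b * \<beta>^3 + c * \<beta>\<^sup>2 + d * \<beta> + e \<ge> 0"
    and "\<gamma>^4 + b * \<gamma>^3 + c * \<gamma>\<^sup>2 + d * \<gamma> + e \<le> 0"
    and z: "z^4 + of_real b * z^3 + of_real c * z\<^sup>2 + of_real d * z + of_real e = 0"
  shows "z \<in> \<real>"
proof -
  define f where "f t = t^4 + b * t^3 + c * t\<^sup>2 + d * t + e" for t :: real
  have "continuous_on {\<alpha>..\<beta>} f"
    unfolding f_def by (intro continuous_intros)
  then obtain r where r: "\<alpha> \<le> r" "r \<le> \<beta>" "f r = 0"
    using IVT'[of f \<alpha> 0 \<beta>] assms unfolding f_def by auto
  define b' c' d' where "b' = b + r" and "c' = c + r * b'" and "d' = d + r * c'"
  define h where "h t = t^3 + b' * t\<^sup>2 + c' * t + d'" for t :: real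
  have e: "e = - (r^4 + b * r^3 + c * r\<^sup>2 + d * r)"
    using r(3) unfolding f_def by linarith
  have fact: "f t = (t - r) * h t" for t
    unfolding f_def h_def e d'_def c'_def b'_def
    by (simp add: power2_eq_square power3_eq_cube power4_eq_xxxx algebra_simps)
  have h\<gamma>: "h \<gamma> \<le> 0"
    using assms(2,5) r fact[of \<gamma>] unfolding f_def by (simp add: mult_le_0_iff)
  have "\<exists>t < \<gamma>. h t \<ge> 0"
  proof (cases "r = \<beta>")
    case True
    then have "h \<alpha> \<ge> 0"
      using assms(1,3) fact[of \<alpha>] unfolding f_def by (simp add: mult_le_0_iff)
    then show ?thesis
      using assms(1,2) by (intro exI[of _ \<alpha>]) simp
  next
    case False
    then have "h \<beta> \<ge> 0"
      using assms(4) r fact[of \<beta>] unfolding f_def by (simp add: zero_le_mult_iff)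
    then show ?thesis
      using assms(2) by blast
  qed
  then obtain t where t: "t < \<gamma>" "t^3 + b' * t\<^sup>2 + c' * t + d' \<ge> 0"
    unfolding h_def by blast
  have "z^4 + of_real b * z^3 + of_real c * z\<^sup>2 + of_real d * z + of_real e
      = (z - of_real r) * (z^3 + of_real b' * z\<^sup>2 + of_real c' * z + of_real d')"
    unfolding e d'_def c'_def b'_def
    by (simp add: power2_eq_square power3_eq_cube power4_eq_xxxx algebra_simps)
  with z have "z = of_real r \<or> z^3 + of_real b' * z\<^sup>2 + of_real c' * z + of_real d' = 0"
    by (metis mult_eq_0_iff right_minus_eq)
  with cubic_roots_real[OF t h\<gamma>[unfolded h_def]] show ?thesis
    by auto
qed

text \<open>
  On a line in direction \<open>e\<close>, centred so that the last two coordinates are \<open>t + k\<close> and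
  \<open>t - k\<close>, the polynomial is the quartic below, with \<open>P = x\<^sub>1 + x\<^sub>2\<close> and \<open>N = x\<^sub>1 x\<^sub>2\<close>.
  It is a square at \<open>t = - P / 2\<close>, and a point with a nonpositive value exists on either
  side: \<open>- 2 P\<close> and \<open>0\<close> if \<open>2 k \<le> P\<close>, the points \<open>k\<close> and \<open>- k\<close> if \<open>2 k > P\<close> and \<open>N \<le> 0\<close>,
  and otherwise the roots of \<open>(t + 2 P)\<^sup>2 = 2 P\<^sup>2 + k\<^sup>2\<close>. Only \<open>P = k = 0\<close> is an
  exception, where the quartic is \<open>t\<^sup>2 (t\<^sup>2 + 16 N)\<close> with \<open>N \<le> 0\<close>.
\<close>

lemma p_G4_quartic_roots_real_nonneg:
  fixes P N k :: real and z :: complex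
  assumes P: "P \<ge> 0" and N: "4 * N \<le> P\<^sup>2" and k: "k \<ge> 0"
    and z: "z^4 + of_real (8 * P) * z^3 + of_real (4 * P\<^sup>2 + 16 * N - 2 * k\<^sup>2) * z\<^sup>2
      + of_real (8 * N * P - 8 * P * k\<^sup>2) * z + of_real (k^4 - 4 * P\<^sup>2 * k\<^sup>2) = 0"
  shows "z \<in> \<real>"
proof -
  define f where "f t = t^4 + 8 * P * t^3 + (4 * P\<^sup>2 + 16 * N - 2 * k\<^sup>2) * t\<^sup>2
      + (8 * N * P - 8 * P * k\<^sup>2) * t + (k^4 - 4 * P\<^sup>2 * k\<^sup>2)" for t
  have signs: "z \<in> \<real>" if "\<alpha> < \<beta>" "\<beta> < \<gamma>" "f \<alpha> \<le> 0" "f \<beta> \<ge> 0" "f \<gamma> \<le> 0" for \<alpha> \<beta> \<gamma>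
    using quartic_roots_real[OF that(1,2) that(3-5)[unfolded f_def] z] .
  have "f (- P / 2) = (P\<^sup>2 / 4 - k\<^sup>2)\<^sup>2"
    unfolding f_def by (simp add: power2_eq_square power3_eq_cube power4_eq_xxxx field_simps)
  then have mid: "f (- P / 2) \<ge> 0"
    by simp
  consider "P = 0" "k = 0" | "P > 0" "2 * k \<le> P" | "2 * k > P" "N \<le> 0" | "2 * k > P" "N > 0"
    using P k by linarith
  then show ?thesis
  proof cases
    case 1
    with z have "z\<^sup>2 * (z\<^sup>2 + of_real (16 * N)) = 0"
      by (simp add: power2_eq_square power4_eq_xxxx algebra_simps)
    moreover have "z \<in> \<real>" if "z\<^sup>2 + of_real (16 * N) = 0"
      using quadratic_roots_real[of 0 0 "16 * N" z] that N 1 by simp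
    ultimately show ?thesis
      by auto
  next
    case 2
    have k2: "4 * k\<^sup>2 \<le> P\<^sup>2"
      using power_mono[OF 2(2), of 2] k by (simp add: power_mult_distrib)
    have "k\<^sup>2 \<le> P\<^sup>2"
      using k2 zero_le_power2[of k] by linarith
    then have k4: "k^4 \<le> P\<^sup>2 * k\<^sup>2"
      using mult_right_mono[of "k\<^sup>2" "P\<^sup>2" "k\<^sup>2"] by (simp add: power2_eq_square power4_eq_xxxx)
    have "0 \<le> P\<^sup>2 * k\<^sup>2"
      by simp
    with k4 have "f 0 \<le> 0"
      unfolding f_def by (simp only: power_zero_numeral)
    moreover have "f (- 2 * P) = k^4 + 4 * P\<^sup>2 * k\<^sup>2 + 48 * N * P\<^sup>2 - 32 * P\<^sup>2 * P\<^sup>2"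
      unfolding f_def by (simp add: power2_eq_square power3_eq_cube power4_eq_xxxx algebra_simps)
    moreover have "48 * N * P\<^sup>2 \<le> 12 * P\<^sup>2 * P\<^sup>2"
      using mult_right_mono[OF N, of "P\<^sup>2"] by simp
    moreover have "4 * P\<^sup>2 * k\<^sup>2 \<le> P\<^sup>2 * P\<^sup>2"
      using mult_left_mono[OF k2, of "P\<^sup>2"] by simp
    moreover have "0 \<le> P\<^sup>2 * P\<^sup>2"
      by simp
    ultimately have "f (- 2 * P) \<le> 0"
      using k4 by linarith
    with \<open>f 0 \<le> 0\<close> mid 2 show ?thesis
      by (intro signs[of "- 2 * P" "- P / 2" 0]) auto
  next
    case 3
    have "f k = 8 * N * (k * (P + 2 * k))" "f (- k) = 8 * N * (k * (2 * k - P))"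
      unfolding f_def by (simp_all add: power2_eq_square power3_eq_cube power4_eq_xxxx algebra_simps)
    moreover have "k * (P + 2 * k) \<ge> 0" "k * (2 * k - P) \<ge> 0"
      using 3 P k by simp_all
    ultimately have "f k \<le> 0" "f (- k) \<le> 0"
      using 3 by (simp_all add: mult_nonpos_nonneg)
    then show ?thesis
      using mid 3 P k by (intro signs[of "- k" "- P / 2" k]) auto
  next
    case 4
    define w where "w = sqrt (2 * P\<^sup>2 + k\<^sup>2)"
    have w2: "w\<^sup>2 = 2 * P\<^sup>2 + k\<^sup>2"
      unfolding w_def by simp
    have "P\<^sup>2 < (2 * k)\<^sup>2"
      using 4 P by (intro power_strict_mono) auto
    then have "(3 * P / 2)\<^sup>2 < w\<^sup>2"
      unfolding w2 by (simp add: power_mult_distrib power_divide)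
    then have w: "3 * P / 2 < w"
      by (rule power_less_imp_less_base) (simp add: w_def)
    \<comment> \<open>The quartic is \<open>q\<^sup>2 - 4 (P + 2 t) (P^3 + 2 t (P\<^sup>2 - N))\<close> with
      \<open>q = (t + 2 P)\<^sup>2 - w\<^sup>2\<close>; the product of the two linear factors is nonnegative at
      both roots of \<open>q\<close>.\<close>
    have val: "f t = - 4 * ((P + 2 * t) * (P^3 + 2 * t * (P\<^sup>2 - N)))" if "(t + 2 * P)\<^sup>2 = w\<^sup>2" for t
    proof -
      have "f t = ((t + 2 * P)\<^sup>2 - w\<^sup>2)\<^sup>2 - 4 * ((P + 2 * t) * (P^3 + 2 * t * (P\<^sup>2 - N)))"
        unfolding f_def w2
        by (simp add: power2_eq_square power3_eq_cube power4_eq_xxxx algebra_simps)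
      with that show ?thesis
        by simp
    qed
    have PN: "P\<^sup>2 - N \<ge> 3 * P\<^sup>2 / 4" "P\<^sup>2 - N \<ge> 0"
      using N zero_le_power2[of P] by linarith+
    have "f (- 2 * P - w) \<le> 0"
    proof -
      let ?t = "- 2 * P - w"
      have "2 * ?t * (P\<^sup>2 - N) \<le> - 4 * P * (P\<^sup>2 - N)"
        using PN w P by (intro mult_right_mono) auto
      also have "\<dots> \<le> - 4 * P * (3 * P\<^sup>2 / 4)"
        using mult_left_mono[OF PN(1), of "4 * P"] P by simp
      also have "\<dots> = - 3 * P^3"
        by (simp add: power2_eq_square power3_eq_cube)
      finally have "P^3 + 2 * ?t * (P\<^sup>2 - N) \<le> 0"
        using zero_le_power[OF P, of 3] by linarith
      moreover have "P + 2 * ?t \<le> 0"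
        using w P by simp
      ultimately have "(P + 2 * ?t) * (P^3 + 2 * ?t * (P\<^sup>2 - N)) \<ge> 0"
        by (rule mult_nonpos_nonpos[rotated])
      then show ?thesis
        using val[of ?t] by simp
    qed
    moreover have "f (- 2 * P + w) \<le> 0"
    proof -
      let ?t = "- 2 * P + w"
      have pos: "P + 2 * ?t \<ge> 0"
        using w by simp
      have "P^3 + 2 * ?t * (P\<^sup>2 - N) \<ge> 0"
      proof (cases "?t \<ge> 0")
        case True
        then show ?thesis
          using PN P by simp
      next
        case False
        have "P^3 + 2 * ?t * (P\<^sup>2 - N) = P\<^sup>2 * (P + 2 * ?t) - 2 * ?t * N"
          by (simp add: power2_eq_square power3_eq_cube algebra_simps)
        moreover have "P\<^sup>2 * (P + 2 * ?t) \<ge> 0"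
          using pos by simp
        moreover have "2 * ?t * N \<le> 0"
          using False 4 by (simp add: mult_le_0_iff)
        ultimately show ?thesis
          by linarith
      qed
      with pos have "(P + 2 * ?t) * (P^3 + 2 * ?t * (P\<^sup>2 - N)) \<ge> 0"
        by (rule mult_nonneg_nonneg)
      then show ?thesis
        using val[of ?t] by simp
    qed
    ultimately show ?thesis
      using mid w P by (intro signs[of "- 2 * P - w" "- P / 2" "- 2 * P + w"]) auto
  qed
qed

lemma p_G4_quartic_roots_real:
  fixes P N k :: real and z :: complex
  assumes N: "4 * N \<le> P\<^sup>2"
    and z: "z^4 + of_real (8 * P) * z^3 + of_real (4 * P\<^sup>2 + 16 * N - 2 * k\<^sup>2) * z\<^sup>2
      + of_real (8 * N * P - 8 * P * k\<^sup>2) * z + of_real (k^4 - 4 * P\<^sup>2 * k\<^sup>2) = 0"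
  shows "z \<in> \<real>"
proof (cases "P \<ge> 0")
  case True
  then show ?thesis
    using p_G4_quartic_roots_real_nonneg[of P N "\<bar>k\<bar>" z] N z by (simp add: power_even_abs)
next
  case False
  then have "- z \<in> \<real>"
    \<comment> \<open>The quartic is invariant under changing the signs of \<open>P\<close> and of the variable.\<close>
    using p_G4_quartic_roots_real_nonneg[of "- P" N "\<bar>k\<bar>" "- z"] N z
    by (simp add: power_even_abs algebra_simps)
  then show ?thesis
    by simp
qed

section \<open>Polynomials: evaluation, weights and Newton polytopes\<close>

lemma poly_mapping_eq_sum_single:
  "p = (\<Sum>m\<in>Poly_Mapping.keys p. Poly_Mapping.single m (Poly_Mapping.lookup p m))"
proof (rule poly_mapping_eqI)
  fix n
  show "Poly_Mapping.lookup p n = Poly_Mapping.lookup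
      (\<Sum>m\<in>Poly_Mapping.keys p. Poly_Mapping.single m (Poly_Mapping.lookup p m)) n"
    by (simp add: lookup_sum lookup_single when_def in_keys_iff)
qed

lemma mult_eq_sum_single:
  fixes p q :: "'b::monoid_add \<Rightarrow>\<^sub>0 'c::semiring_0"
  shows "p * q = (\<Sum>m\<in>Poly_Mapping.keys p. \<Sum>n\<in>Poly_Mapping.keys q.
    Poly_Mapping.single (m + n) (Poly_Mapping.lookup p m * Poly_Mapping.lookup q n))"
  by (subst (1) poly_mapping_eq_sum_single[of p], subst (1) poly_mapping_eq_sum_single[of q])
     (simp add: sum_product mult_single)

lemma lookup_mult_eq_sum:
  fixes p q :: "'b::monoid_add \<Rightarrow>\<^sub>0 'c::semiring_0"
  assumes "finite A" "Poly_Mapping.keys p \<subseteq> A" "finite B" "Poly_Mapping.keys q \<subseteq> B"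
  shows "Poly_Mapping.lookup (p * q) l = (\<Sum>m\<in>A. \<Sum>n\<in>B.
    if m + n = l then Poly_Mapping.lookup p m * Poly_Mapping.lookup q n else 0)"
proof -
  have "Poly_Mapping.lookup (p * q) l
      = (\<Sum>m\<in>Poly_Mapping.keys p. \<Sum>n\<in>Poly_Mapping.keys q.
          if m + n = l then Poly_Mapping.lookup p m * Poly_Mapping.lookup q n else 0)"
    by (simp add: mult_eq_sum_single[of p q] lookup_sum lookup_single when_def)
  also have "\<dots> = (\<Sum>m\<in>A. \<Sum>n\<in>Poly_Mapping.keys q.
      if m + n = l then Poly_Mapping.lookup p m * Poly_Mapping.lookup q n else 0)"
    by (rule sum.mono_neutral_left) (use assms in \<open>auto simp: in_keys_iff intro!: sum.neutral\<close>)
  also have "\<dots> = (\<Sum>m\<in>A. \<Sum>n\<in>B.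
      if m + n = l then Poly_Mapping.lookup p m * Poly_Mapping.lookup q n else 0)"
    by (rule sum.cong[OF refl], rule sum.mono_neutral_left)
       (use assms in \<open>auto simp: in_keys_iff\<close>)
  finally show ?thesis .
qed

lemma eval_rpoly_superset:
  assumes "finite A" "Poly_Mapping.keys p \<subseteq> A"
  shows "eval_rpoly p a = (\<Sum>m\<in>A. of_real (Poly_Mapping.lookup p m)
    * (\<Prod>i\<in>UNIV. (a $ i) ^ Poly_Mapping.lookup m i))"
  unfolding eval_rpoly_def
  by (rule sum.mono_neutral_left) (use assms in \<open>auto simp: in_keys_iff\<close>)

lemma eval_rpoly_zero [simp]: "eval_rpoly 0 a = 0"
  by (simp add: eval_rpoly_def)

lemma eval_rpoly_single:
  "eval_rpoly (Poly_Mapping.single m c) a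
    = of_real c * (\<Prod>i\<in>UNIV. (a $ i) ^ Poly_Mapping.lookup m i)"
  by (subst eval_rpoly_superset[of "{m}"]) auto

lemma eval_rpoly_add [simp]: "eval_rpoly (p + q) a = eval_rpoly p a + eval_rpoly q a"
proof -
  let ?A = "Poly_Mapping.keys p \<union> Poly_Mapping.keys q"
  have "Poly_Mapping.keys (p + q) \<subseteq> ?A"
    by (rule keys_add)
  then show ?thesis
    by (subst (1 2 3) eval_rpoly_superset[of ?A])
       (auto simp: lookup_add distrib_right sum.distrib)
qed

lemma eval_rpoly_uminus [simp]: "eval_rpoly (- p) a = - eval_rpoly p a"
  by (subst (1 2) eval_rpoly_superset[of "Poly_Mapping.keys p"])
     (auto simp: in_keys_iff sum_negf)

lemma eval_rpoly_diff [simp]: "eval_rpoly (p - q) a = eval_rpoly p a - eval_rpoly q a"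
  using eval_rpoly_add[of p "- q" a] by simp

lemma eval_rpoly_sum: "eval_rpoly (sum f A) a = (\<Sum>i\<in>A. eval_rpoly (f i) a)"
  by (induction A rule: infinite_finite_induct) auto

lemma eval_rpoly_mult [simp]: "eval_rpoly (p * q) a = eval_rpoly p a * eval_rpoly q a"
  unfolding mult_eq_sum_single[of p q]
  by (simp add: eval_rpoly_sum eval_rpoly_single lookup_add power_add prod.distrib)
     (simp add: eval_rpoly_def sum_product mult_ac)

lemma eval_rpoly_one [simp]: "eval_rpoly 1 a = 1"
  using eval_rpoly_single[of 0 1 a] by (simp flip: single_one)

lemma eval_rpoly_numeral [simp]: "eval_rpoly (numeral n) a = numeral n"
  using eval_rpoly_single[of 0 "numeral n" a] by (simp flip: single_numeral)

lemma eval_rpoly_power [simp]: "eval_rpoly (p ^ n) a = eval_rpoly p a ^ n"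
  by (induction n) auto

lemma eval_rpoly_Var [simp]: "eval_rpoly (Var i) a = a $ i"
proof -
  have "(\<Prod>j\<in>UNIV. (a $ j) ^ (Poly_Mapping.lookup (Poly_Mapping.single i 1) j))
      = (\<Prod>j\<in>UNIV. if j = i then a $ j else 1)"
    by (rule prod.cong) (auto simp: lookup_single when_def)
  then show ?thesis
    by (simp add: Var_def eval_rpoly_single)
qed

text \<open>
  The weight of an exponent vector with respect to integer weights of the variables.
  Negative weights are allowed, so that upper bounds on weights also express lower
  bounds on exponents.
\<close>

definition weight :: "('n::finite \<Rightarrow> int) \<Rightarrow> ('n \<Rightarrow>\<^sub>0 nat) \<Rightarrow> int" where
  "weight w m = (\<Sum>i\<in>UNIV. w i * int (Poly_Mapping.lookup m i))"

lemma weight_add: "weight w (m + n) = weight w m + weight w n"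
  by (simp add: weight_def lookup_add distrib_left sum.distrib)

lemma base_expansion_unique:
  fixes f g :: "nat \<Rightarrow> nat"
  assumes "\<And>i. f i < K" "\<And>i. g i < K" "(\<Sum>i<n. K ^ i * f i) = (\<Sum>i<n. K ^ i * g i)" "i < n"
  shows "f i = g i"
  using assms
proof (induction n arbitrary: f g i)
  case (Suc n)
  have split: "(\<Sum>i<Suc n. K ^ i * h i) = h 0 + K * (\<Sum>i<n. K ^ i * h (Suc i))" for h :: "nat \<Rightarrow> nat"
    by (subst sum.lessThan_Suc_shift) (simp add: sum_distrib_left mult_ac)
  have eq: "f 0 + K * (\<Sum>i<n. K ^ i * f (Suc i)) = g 0 + K * (\<Sum>i<n. K ^ i * g (Suc i))"
    using Suc.prems(3) unfolding split .
  have "f 0 = g 0"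
    using arg_cong[OF eq, of "\<lambda>x. x mod K"] Suc.prems(1,2) by simp
  moreover have "f (Suc j) = g (Suc j)" if "j < n" for j
    using Suc.IH[of "f \<circ> Suc" "g \<circ> Suc" j] Suc.prems(1,2) eq \<open>f 0 = g 0\<close> that
    by (cases "K = 0") auto
  ultimately show ?case
    using Suc.prems(4) by (cases i) auto
qed simp

text \<open>
  Powers of a base exceeding all exponents serve as weights that separate finitely many
  exponent vectors (Kronecker substitution).
\<close>

lemma ex_inj_on_weight:
  fixes S :: "('n::finite \<Rightarrow>\<^sub>0 nat) set"
  assumes "finite S"
  shows "\<exists>w :: 'n \<Rightarrow> nat. inj_on (weight (\<lambda>i. int (w i))) S"
proof -
  obtain r where r: "bij_betw r (UNIV :: 'n set) {..<CARD('n)}"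
    using ex_bij_betw_finite_nat[of "UNIV :: 'n set"]
    by (auto simp: atLeast0LessThan)
  define r' where "r' = inv_into UNIV r"
  have r': "r' (r i) = i" for i
    using r unfolding r'_def by (meson UNIV_I bij_betw_inv_into_left)
  define K where "K = Suc (\<Sum>m\<in>S. \<Sum>i\<in>UNIV. Poly_Mapping.lookup m i)"
  have K: "Poly_Mapping.lookup m i < K" if "m \<in> S" for m i
  proof -
    have "Poly_Mapping.lookup m i \<le> (\<Sum>i\<in>UNIV. Poly_Mapping.lookup m i)"
      by (rule member_le_sum) auto
    also have "\<dots> \<le> (\<Sum>m\<in>S. \<Sum>i\<in>UNIV. Poly_Mapping.lookup m i)"
      using that assms by (intro member_le_sum) auto
    finally show ?thesis
      unfolding K_def by simp
  qed
  have weight: "weight (\<lambda>i. int (K ^ r i)) m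
      = int (\<Sum>j<CARD('n). K ^ j * Poly_Mapping.lookup m (r' j))" for m
  proof -
    have "(\<Sum>j<CARD('n). K ^ j * Poly_Mapping.lookup m (r' j))
        = (\<Sum>i\<in>UNIV. K ^ r i * Poly_Mapping.lookup m i)"
      using sum.reindex_bij_betw[OF r, of "\<lambda>j. K ^ j * Poly_Mapping.lookup m (r' j)"]
      by (simp add: r')
    then show ?thesis
      by (simp add: weight_def)
  qed
  have "inj_on (weight (\<lambda>i. int (K ^ r i))) S"
  proof (rule inj_onI)
    fix m n
    assume mn: "m \<in> S" "n \<in> S" and "weight (\<lambda>i. int (K ^ r i)) m = weight (\<lambda>i. int (K ^ r i)) n"
    then have eq: "(\<Sum>j<CARD('n). K ^ j * Poly_Mapping.lookup m (r' j))
        = (\<Sum>j<CARD('n). K ^ j * Poly_Mapping.lookup n (r' j))"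
      unfolding weight of_nat_eq_iff by simp
    have "Poly_Mapping.lookup m (r' (r i)) = Poly_Mapping.lookup n (r' (r i))" for i
      using base_expansion_unique[OF _ _ eq, of "r i"] K mn bij_betwE[OF r] by auto
    then show "m = n"
      by (intro poly_mapping_eqI) (simp add: r')
  qed
  then show ?thesis
    by (intro exI[of _ "\<lambda>i. K ^ r i"])
qed

lemma rpoly_eq_0I:
  fixes p :: "'n::finite rpoly"
  assumes "\<And>x :: real ^ 'n. eval_rpoly p x = 0"
  shows "p = 0"
proof -
  obtain w :: "'n \<Rightarrow> nat" where w: "inj_on (weight (\<lambda>i. int (w i))) (Poly_Mapping.keys p)"
    using ex_inj_on_weight[OF finite_keys] by blast
  define \<phi> where "\<phi> m = (\<Sum>i\<in>UNIV. w i * Poly_Mapping.lookup m i)" for m :: "'n \<Rightarrow>\<^sub>0 nat"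
  have \<phi>: "m = n" if "m \<in> Poly_Mapping.keys p" "n \<in> Poly_Mapping.keys p" "\<phi> m = \<phi> n" for m n
  proof (rule inj_onD[OF w _ that(1,2)])
    show "weight (\<lambda>i. int (w i)) m = weight (\<lambda>i. int (w i)) n"
      using arg_cong[OF that(3), of int] by (simp add: weight_def \<phi>_def)
  qed
  define P where "P = (\<Sum>m\<in>Poly_Mapping.keys p. Polynomial.monom (Poly_Mapping.lookup p m) (\<phi> m))"
  have "poly P t = eval_rpoly p (\<chi> i. t ^ w i)" for t
    by (simp add: P_def poly_sum poly_monom eval_rpoly_def \<phi>_def power_sum flip: power_mult)
  then have "P = 0"
    using assms by (simp flip: poly_all_0_iff_0)
  have "Poly_Mapping.lookup p m = 0" for m
  proof (cases "m \<in> Poly_Mapping.keys p")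
    case True
    have "Polynomial.coeff P (\<phi> m)
        = (\<Sum>n\<in>Poly_Mapping.keys p. if n = m then Poly_Mapping.lookup p n else 0)"
      unfolding P_def coeff_sum
      by (rule sum.cong) (use \<phi> True in \<open>auto simp: coeff_monom\<close>)
    with True \<open>P = 0\<close> show ?thesis
      by simp
  qed (simp add: in_keys_iff)
  then show ?thesis
    by (intro poly_mapping_eqI) simp
qed

text \<open>
  A half-space containing the Newton polytope of a sum of squares contains, scaled by
  one half, the Newton polytopes of the summands: at an extreme vertex \<open>m\<close> of the union
  of the supports, the monomial \<open>2 m\<close> arises only from squares of coefficients, which
  cannot cancel.
\<close>

lemma weight_le_of_sum_squares:
  fixes q :: "'k \<Rightarrow> 'n::finite rpoly"
  assumes fin: "finite I"
    and bound: "\<And>m. m \<in> Poly_Mapping.keys (\<Sum>k\<in>I. q k * q k) \<Longrightarrow> weight w m \<le> 2 * D"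
    and "k \<in> I" "m \<in> Poly_Mapping.keys (q k)"
  shows "weight w m \<le> D"
proof -
  define S where "S = (\<Union>k\<in>I. Poly_Mapping.keys (q k))"
  have "finite S"
    unfolding S_def using fin by auto
  have "m \<in> S"
    unfolding S_def using assms by auto
  define W where "W = Max (weight w ` S)"
  define T where "T = {m \<in> S. weight w m = W}"
  have W: "weight w n \<le> W" if "n \<in> S" for n
    unfolding W_def using \<open>finite S\<close> that by simp
  have "T \<noteq> {}"
    using Max_in[of "weight w ` S"] \<open>finite S\<close> \<open>m \<in> S\<close> unfolding T_def W_def by fastforce
  moreover have "finite T"
    unfolding T_def using \<open>finite S\<close> by simp
  \<comment> \<open>A generic second weight singles out one vertex \<open>m0\<close> of the face \<open>T\<close> of maximal
    weight.\<close>
  obtain v :: "'n \<Rightarrow> nat" where "inj_on (weight (\<lambda>i. int (v i))) T"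
    using ex_inj_on_weight[OF \<open>finite T\<close>] by blast
  define \<phi> where "\<phi> = weight (\<lambda>i. int (v i))"
  have inj: "inj_on \<phi> T"
    unfolding \<phi>_def by fact
  obtain m0 where m0: "m0 \<in> T" "\<And>n. n \<in> T \<Longrightarrow> \<phi> n \<le> \<phi> m0"
    using Max_in[of "\<phi> ` T"] Max_ge[of "\<phi> ` T"] \<open>finite T\<close> \<open>T \<noteq> {}\<close>
    by (metis (no_types, lifting) finite_imageI image_iff image_is_empty imageI)
  have unique: "n = m0 \<and> n' = m0" if "n \<in> S" "n' \<in> S" "n + n' = m0 + m0" for n n'
  proof -
    have "weight w n + weight w n' = 2 * W"
      using arg_cong[OF that(3), of "weight w"] m0(1) by (simp add: weight_add T_def)
    then have nT: "n \<in> T" "n' \<in> T"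
      using W[OF that(1)] W[OF that(2)] that unfolding T_def by auto
    have "\<phi> n + \<phi> n' = 2 * \<phi> m0"
      using arg_cong[OF that(3), of \<phi>] by (simp add: \<phi>_def weight_add)
    then have "\<phi> n = \<phi> m0" "\<phi> n' = \<phi> m0"
      using m0(2)[OF nT(1)] m0(2)[OF nT(2)] by linarith+
    then show ?thesis
      using inj_onD[OF inj] nT m0(1) by blast
  qed
  have "Poly_Mapping.lookup (q k * q k) (m0 + m0) = (Poly_Mapping.lookup (q k) m0)\<^sup>2"
    if "k \<in> I" for k
  proof -
    have "Poly_Mapping.lookup (q k * q k) (m0 + m0) = (\<Sum>n\<in>S. \<Sum>n'\<in>S.
        if n + n' = m0 + m0 then Poly_Mapping.lookup (q k) n * Poly_Mapping.lookup (q k) n' else 0)"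
      using \<open>finite S\<close> that by (intro lookup_mult_eq_sum) (auto simp: S_def)
    also have "\<dots> = (\<Sum>n\<in>S. \<Sum>n'\<in>S. if n = m0 \<and> n' = m0 then (Poly_Mapping.lookup (q k) m0)\<^sup>2 else 0)"
      by (intro sum.cong refl) (auto simp: power2_eq_square dest: unique)
    also have "\<dots> = (\<Sum>n\<in>S. if n = m0 then (Poly_Mapping.lookup (q k) m0)\<^sup>2 else 0)"
      using \<open>finite S\<close> m0(1) by (intro sum.cong refl) (auto simp: T_def)
    also have "\<dots> = (Poly_Mapping.lookup (q k) m0)\<^sup>2"
      using \<open>finite S\<close> m0(1) by (simp add: T_def)
    finally show ?thesis .
  qed
  then have "Poly_Mapping.lookup (\<Sum>k\<in>I. q k * q k) (m0 + m0)
      = (\<Sum>k\<in>I. (Poly_Mapping.lookup (q k) m0)\<^sup>2)"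
    by (simp add: lookup_sum)
  moreover have "(\<Sum>k\<in>I. (Poly_Mapping.lookup (q k) m0)\<^sup>2) \<noteq> 0"
  proof -
    obtain k0 where "k0 \<in> I" "Poly_Mapping.lookup (q k0) m0 \<noteq> 0"
      using m0(1) unfolding T_def S_def by (auto simp: in_keys_iff)
    then show ?thesis
      using fin by (auto simp: sum_nonneg_eq_0_iff)
  qed
  ultimately have "weight w (m0 + m0) \<le> 2 * D"
    by (intro bound) (simp add: in_keys_iff)
  then show ?thesis
    using m0(1) W[OF \<open>m \<in> S\<close>] by (simp add: weight_add T_def)
qed

section \<open>Polynomials in four variables\<close>

text \<open>
  The exponent vector of \<open>x\<^sub>1^i x\<^sub>2^j x\<^sub>3^k x\<^sub>4^l\<close>.
\<close>

definition monom4 :: "nat \<Rightarrow> nat \<Rightarrow> nat \<Rightarrow> nat \<Rightarrow> (4 \<Rightarrow>\<^sub>0 nat)" where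
  "monom4 i j k l = Poly_Mapping.single 1 i + Poly_Mapping.single 2 j
     + Poly_Mapping.single 3 k + Poly_Mapping.single 4 l"

lemma lookup_monom4 [simp]:
  "Poly_Mapping.lookup (monom4 i j k l) 1 = i" "Poly_Mapping.lookup (monom4 i j k l) 2 = j"
  "Poly_Mapping.lookup (monom4 i j k l) 3 = k" "Poly_Mapping.lookup (monom4 i j k l) 4 = l"
  by (simp_all add: monom4_def lookup_add lookup_single)

lemma poly_mapping_4_eq_iff:
  fixes m n :: "4 \<Rightarrow>\<^sub>0 'b::zero"
  shows "m = n \<longleftrightarrow> Poly_Mapping.lookup m 1 = Poly_Mapping.lookup n 1
    \<and> Poly_Mapping.lookup m 2 = Poly_Mapping.lookup n 2
    \<and> Poly_Mapping.lookup m 3 = Poly_Mapping.lookup n 3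
    \<and> Poly_Mapping.lookup m 4 = Poly_Mapping.lookup n 4"
  unfolding poly_mapping_eq_iff fun_eq_iff forall_4 ..

lemma monom4_eq_iff [simp]: "monom4 i j k l = monom4 i' j' k' l' \<longleftrightarrow> i = i' \<and> j = j' \<and> k = k' \<and> l = l'"
  by (simp add: poly_mapping_4_eq_iff)

lemma monom4_add [simp]: "monom4 i j k l + monom4 i' j' k' l' = monom4 (i + i') (j + j') (k + k') (l + l')"
  by (simp add: poly_mapping_4_eq_iff lookup_add)

lemma monom4_lookup: "m = monom4 (Poly_Mapping.lookup m 1) (Poly_Mapping.lookup m 2)
    (Poly_Mapping.lookup m 3) (Poly_Mapping.lookup m 4)"
  by (simp add: poly_mapping_4_eq_iff)

lemma weight_monom4 [simp]:
  "weight w (monom4 i j k l) = w 1 * int i + w 2 * int j + w 3 * int k + w 4 * int l"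
  by (simp add: weight_def sum_4)

lemma prod_4: "prod f (UNIV :: 4 set) = f 1 * f 2 * f 3 * f 4"
  unfolding UNIV_4 by (simp add: ac_simps)

lemma eval_rpoly_single_monom4:
  "eval_rpoly (Poly_Mapping.single (monom4 i j k l) c) a
    = of_real c * (vec_nth a 1 ^ i * vec_nth a 2 ^ j * vec_nth a 3 ^ k * vec_nth a 4 ^ l)"
  by (simp add: eval_rpoly_single prod_4)

lemma vector_4 [simp]:
  "(vector [x, y, z, w] :: 'a::zero ^ 4) $ 1 = x" "(vector [x, y, z, w] :: 'a::zero ^ 4) $ 2 = y"
  "(vector [x, y, z, w] :: 'a::zero ^ 4) $ 3 = z" "(vector [x, y, z, w] :: 'a::zero ^ 4) $ 4 = w"
  unfolding vector_def by simp_all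

text \<open>
  Homogeneity of a given degree; unlike the total degree, it lets the zero polynomial be
  homogeneous of every degree, which makes it compatible with sums and products.
\<close>

definition form :: "nat \<Rightarrow> 'n::finite rpoly \<Rightarrow> bool" where
  "form d p \<longleftrightarrow> (\<forall>m\<in>Poly_Mapping.keys p. mono_degree m = d)"

lemma mono_degree_add: "mono_degree (m + n) = mono_degree m + mono_degree n"
  by (simp add: mono_degree_def lookup_add sum.distrib)

lemma form_add: "form d p \<Longrightarrow> form d q \<Longrightarrow> form d (p + q)"
  using keys_add[of p q] unfolding form_def by blast

lemma form_mult: "form d p \<Longrightarrow> form d' q \<Longrightarrow> form (d + d') (p * q)"
  using keys_mult[of p q] unfolding form_def by (fastforce simp: mono_degree_add)

lemma form_numeral: "form 0 (numeral n)"
  unfolding form_def by (simp flip: single_numeral add: mono_degree_def)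

lemma form_Var: "form 1 (Var i)"
  by (simp add: form_def Var_def mono_degree_def lookup_single when_def)

lemma form_total_degree:
  assumes "form d p" "p \<noteq> 0"
  shows "total_degree p = d"
proof -
  obtain m where "m \<in> Poly_Mapping.keys p"
    using assms(2) by (metis ex_in_conv keys_eq_empty)
  then have "mono_degree ` Poly_Mapping.keys p = {d}"
    using assms(1) unfolding form_def by force
  then show ?thesis
    by (simp add: total_degree_def)
qed

lemma vector_4_exhaust:
  fixes x :: "'a::zero ^ 4"
  obtains a b c d where "x = vector [a, b, c, d]"
proof
  show "x = vector [vec_nth x 1, vec_nth x 2, vec_nth x 3, vec_nth x 4]"
    by (simp add: Finite_Cartesian_Product.vec_eq_iff forall_4)
qed

lemma vector_4_add:
  "(vector [a, b, c, d] :: 'a::monoid_add ^ 4) + vector [a', b', c', d']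
    = vector [a + a', b + b', c + c', d + d']"
  by (simp add: Finite_Cartesian_Product.vec_eq_iff forall_4)

lemma vector_4_scaleR:
  "r *\<^sub>R (vector [a, b, c, d] :: real ^ 4) = vector [r * a, r * b, r * c, r * d]"
  by (simp add: Finite_Cartesian_Product.vec_eq_iff forall_4)

lemma eval_p_G4:
  "eval_rpoly p_G4 (vector [a, b, c, d])
    = c\<^sup>2 * d\<^sup>2 + 4 * (a * b * c + a * b * d + a * c * d + b * c * d) * (a + b + c + d)"
  by (simp add: p_G4_def)

lemma form_p_G4: "form 4 p_G4"
proof -
  have deg: "4 = 1 + 1 + (1 + 1)" "4 = 0 + (1 + 1 + 1) + (1 :: nat)"
    by simp_all
  have "form 4 (Var 3 ^ 2 * Var 4 ^ 2 :: 4 rpoly)"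
    unfolding power2_eq_square by (subst deg(1)) (intro form_mult form_Var)
  moreover have "form 4
     (4 * (Var 1 * Var 2 * Var 3 + Var 1 * Var 2 * Var 4 + Var 1 * Var 3 * Var 4
            + Var 2 * Var 3 * Var 4)
         * (Var 1 + Var 2 + Var 3 + Var 4) :: 4 rpoly)"
    by (subst deg(2)) (intro form_mult form_add form_numeral form_Var)
  ultimately show ?thesis
    unfolding p_G4_def by (rule form_add)
qed

lemma total_degree_p_G4: "total_degree p_G4 = 4"
proof (rule form_total_degree[OF form_p_G4])
  have "eval_rpoly p_G4 (vector [0, 0, 1, 1] :: real ^ 4) = 1"
    by (simp add: eval_p_G4)
  then show "p_G4 \<noteq> 0"
    by (metis eval_rpoly_zero zero_neq_one)
qed

lemma dir_deriv_p_G4: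
  "dir_deriv (vector [0, 0, 0, 1]) p_G4 (vector [a, b, c, d]) = 2 * c\<^sup>2 * d
    + 4 * (a * b + (a + b) * c) * (a + b + c + d) + 4 * (a * b * c + a * b * d + a * c * d + b * c * d)"
proof -
  have "((\<lambda>h. c\<^sup>2 * (d + h)\<^sup>2 + 4 * (a * b * c + a * b * (d + h) + a * c * (d + h) + b * c * (d + h))
          * (a + b + c + (d + h))) has_real_derivative
      2 * c\<^sup>2 * d + 4 * (a * b + (a + b) * c) * (a + b + c + d)
        + 4 * (a * b * c + a * b * d + a * c * d + b * c * d)) (at 0)"
    by (rule derivative_eq_intros refl | simp)+ (simp add: algebra_simps)
  then show ?thesis
    unfolding dir_deriv_def vector_4_add vector_4_scaleR eval_p_G4
    by (simp add: DERIV_imp_deriv)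
qed

section \<open>Uniqueness of the Bezoutian and its upper left entry\<close>

lemma polynomial_zero_off_point:
  fixes c :: "nat \<Rightarrow> real"
  assumes "\<And>t. t \<noteq> s \<Longrightarrow> (\<Sum>i<n. c i * t ^ i) = 0" "i < n"
  shows "c i = 0"
proof -
  define P where "P = (\<Sum>i<n. Polynomial.monom (c i) i)"
  have "poly P t = (\<Sum>i<n. c i * t ^ i)" for t
    by (simp add: P_def poly_sum poly_monom)
  then have "- {s} \<subseteq> {t. poly P t = 0}"
    using assms(1) by auto
  moreover have "infinite (- {s})"
    by (simp add: infinite_UNIV_char_0)
  ultimately have "P = 0"
    using poly_roots_finite finite_subset by blast
  moreover have "Polynomial.coeff P i = c i"
    using assms(2) by (simp add: P_def coeff_sum coeff_monom)
  ultimately show ?thesis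
    by simp
qed

text \<open>
  The identity that characterises the Bezoutian determines its entries, because a
  polynomial that vanishes for all real \<open>t \<noteq> s\<close> and all real points is zero.
\<close>

lemma bezoutian_eqI:
  fixes p :: "'n::finite rpoly" and e u :: "real ^ 'n"
  assumes B: "B \<in> carrier_mat (total_degree p) (total_degree p)"
    and eq: "\<And>x t s. t \<noteq> s \<Longrightarrow>
      (eval_rpoly p (x + t *\<^sub>R e) * dir_deriv u p (x + s *\<^sub>R e)
        - dir_deriv u p (x + t *\<^sub>R e) * eval_rpoly p (x + s *\<^sub>R e)) / (t - s)
      = (\<Sum>i<total_degree p. \<Sum>j<total_degree p. eval_rpoly (B $$ (i, j)) x * t ^ i * s ^ j)"
  shows "bezoutian p e u = B"
  unfolding bezoutian_def
proof (rule the_equality)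
  fix C
  assume C: "C \<in> carrier_mat (total_degree p) (total_degree p) \<and>
    (\<forall>x t s. t \<noteq> s \<longrightarrow>
      (eval_rpoly p (x + t *\<^sub>R e) * dir_deriv u p (x + s *\<^sub>R e)
        - dir_deriv u p (x + t *\<^sub>R e) * eval_rpoly p (x + s *\<^sub>R e)) / (t - s)
      = (\<Sum>i<total_degree p. \<Sum>j<total_degree p. eval_rpoly (C $$ (i, j)) x * t ^ i * s ^ j))"
  note Ceq = C[THEN conjunct2, rule_format]
  define d where "d = total_degree p"
  have "C $$ (i, j) = B $$ (i, j)" if ij: "i < d" "j < d" for i j
  proof -
    have "eval_rpoly (C $$ (i, j) - B $$ (i, j)) x = 0" for x :: "real ^ 'n"
    proof -
      define D where "D i j = eval_rpoly (C $$ (i, j)) x - eval_rpoly (B $$ (i, j)) x" for i j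
      have "(\<Sum>i<d. (\<Sum>j<d. D i j * s ^ j) * t ^ i) = 0" if "t \<noteq> s" for s t
      proof -
        have "(\<Sum>i<d. \<Sum>j<d. eval_rpoly (C $$ (i, j)) x * t ^ i * s ^ j)
            = (\<Sum>i<d. \<Sum>j<d. eval_rpoly (B $$ (i, j)) x * t ^ i * s ^ j)"
          unfolding d_def by (rule trans[OF Ceq[OF that, symmetric] eq[OF that]])
        moreover have "(\<Sum>i<d. (\<Sum>j<d. D i j * s ^ j) * t ^ i)
            = (\<Sum>i<d. \<Sum>j<d. eval_rpoly (C $$ (i, j)) x * t ^ i * s ^ j)
              - (\<Sum>i<d. \<Sum>j<d. eval_rpoly (B $$ (i, j)) x * t ^ i * s ^ j)"
          unfolding D_def sum_distrib_right sum_subtractf[symmetric]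
          by (intro sum.cong refl) (simp add: algebra_simps)
        ultimately show ?thesis
          by simp
      qed
      then have "(\<Sum>j<d. D i j * s ^ j) = 0" for s
        by (rule polynomial_zero_off_point[where c = "\<lambda>i. \<Sum>j<d. D i j * s ^ j", OF _ ij(1)])
      then have "D i j = 0"
        by (intro polynomial_zero_off_point[where c = "D i" and s = 0, OF _ ij(2)])
      then show ?thesis
        by (simp add: D_def)
    qed
    then have "C $$ (i, j) - B $$ (i, j) = 0"
      by (rule rpoly_eq_0I)
    then show ?thesis
      by simp
  qed
  then show "C = B"
    using carrier_matD[OF B] carrier_matD[OF C[THEN conjunct1]] unfolding d_def
    by (intro eq_matI) auto
qed (rule conjI[OF B], intro allI impI, erule eq)

text \<open>
  The expanded upper left entry of the Bezoutian: the tuple \<open>(r, i, j, k, l)\<close> stands for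
  the term \<open>r x\<^sub>1^i x\<^sub>2^j x\<^sub>3^k x\<^sub>4^l\<close>.
\<close>

definition bez_terms :: "(real \<times> nat \<times> nat \<times> nat \<times> nat) list" where
  "bez_terms = [
     (32, 4, 2, 0, 0), (32, 4, 1, 1, 0), (16, 4, 0, 2, 0), (64, 3, 3, 0, 0), (160, 3, 2, 1, 0),
     (64, 3, 2, 0, 1), (128, 3, 1, 2, 0), (64, 3, 1, 1, 1), (32, 3, 0, 3, 0), (32, 3, 0, 2, 1),
     (32, 2, 4, 0, 0), (160, 2, 3, 1, 0), (64, 2, 3, 0, 1), (288, 2, 2, 2, 0), (256, 2, 2, 1, 1),
     (64, 2, 2, 0, 2), (120, 2, 1, 3, 0), (224, 2, 1, 2, 1), (88, 2, 1, 1, 2), (16, 2, 0, 4, 0),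
     (40, 2, 0, 3, 1), (44, 2, 0, 2, 2), (32, 1, 4, 1, 0), (128, 1, 3, 2, 0), (64, 1, 3, 1, 1),
     (120, 1, 2, 3, 0), (224, 1, 2, 2, 1), (88, 1, 2, 1, 2), (24, 1, 1, 4, 0), (96, 1, 1, 3, 1),
     (96, 1, 1, 2, 2), (8, 1, 0, 4, 1), (16, 1, 0, 3, 2), (16, 0, 4, 2, 0), (32, 0, 3, 3, 0),
     (32, 0, 3, 2, 1), (16, 0, 2, 4, 0), (40, 0, 2, 3, 1), (44, 0, 2, 2, 2), (8, 0, 1, 4, 1),
     (16, 0, 1, 3, 2), (2, 0, 0, 4, 2)]"

definition bez_corner :: "4 rpoly" where
  "bez_corner = (\<Sum>(r, i, j, k, l) \<leftarrow> bez_terms. Poly_Mapping.single (monom4 i j k l) r)"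

lemma eval_rpoly_sum_list: "eval_rpoly (sum_list ps) x = (\<Sum>p\<leftarrow>ps. eval_rpoly p x)"
  by (induction ps) auto

lemma eval_bez_corner:
  fixes a b c d :: real
  shows "eval_rpoly bez_corner (vector [a, b, c, d])
    = (\<Sum>(r, i, j, k, l) \<leftarrow> bez_terms. r * (a ^ i * b ^ j * c ^ k * d ^ l))"
  by (simp add: bez_corner_def eval_rpoly_sum_list comp_def case_prod_unfold eval_rpoly_single_monom4)

text \<open>
  If \<open>f\<close> and \<open>g\<close> list the coefficients of \<open>t\<close> in \<open>p(x + t e)\<close> and in its derivative in
  direction \<open>u\<close>, then the entries of the Bezoutian are sums of minors
  \<open>f\<^sub>a g\<^sub>b - f\<^sub>b g\<^sub>a\<close> by the classical formula of Bezout; the entry at \<open>(0, 0)\<close> is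
  \<open>f\<^sub>1 g\<^sub>0 - f\<^sub>0 g\<^sub>1\<close>.
\<close>

lemma bezoutian_p_G4_corner:
  defines "e \<equiv> vector [0, 0, 1, 1]" and "u \<equiv> vector [0, 0, 0, 1]"
  shows "dim_row (bezoutian p_G4 e u) = 4" "bezoutian p_G4 e u $$ (0, 0) = bez_corner"
proof -
  define P N S M :: "4 rpoly" where "P = Var 1 + Var 2" and "N = Var 1 * Var 2"
    and "S = Var 3 + Var 4" and "M = Var 3 * Var 4"
  define f where "f = (!) [p_G4,
    2 * M * S + 4 * (2 * (N * S + P * M) + (2 * N + P * S) * (P + S)),
    S\<^sup>2 + 2 * M + 4 * (2 * (2 * N + P * S) + P * (P + S)),
    2 * S + 8 * P, 1]"
  define g where "g = (!) [
    2 * Var 3 ^ 2 * Var 4 + 4 * ((N + P * Var 3) * (P + S) + N * S + P * M),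
    2 * Var 3 ^ 2 + 4 * Var 3 * Var 4
      + 4 * (2 * (N + P * Var 3) + P * (P + S) + 2 * N + P * S),
    4 * Var 3 + 2 * Var 4 + 12 * P, 2, 0]"
  define B where "B = mat 4 4 (\<lambda>(i, j). \<Sum>m\<le>min i (3 - j).
    f (j + m + 1) * g (i - m) - f (i - m) * g (j + m + 1))"
  have f: "eval_rpoly p_G4 (x + t *\<^sub>R e) = (\<Sum>i\<le>4. eval_rpoly (f i) x * t ^ i)" for x t
  proof -
    obtain a b c d where x: "x = vector [a, b, c, d]"
      by (rule vector_4_exhaust)
    show ?thesis
      unfolding x e_def vector_4_scaleR vector_4_add
      by (simp add: eval_p_G4 f_def P_def N_def S_def M_def eval_nat_numeral algebra_simps)
  qed
  have g: "dir_deriv u p_G4 (x + t *\<^sub>R e) = (\<Sum>i\<le>4. eval_rpoly (g i) x * t ^ i)" for x t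
  proof -
    obtain a b c d where x: "x = vector [a, b, c, d]"
      by (rule vector_4_exhaust)
    show ?thesis
      unfolding x e_def u_def vector_4_scaleR vector_4_add dir_deriv_p_G4
      by (simp add: g_def P_def N_def S_def M_def eval_nat_numeral algebra_simps)
  qed
  have "bezoutian p_G4 e u = B"
  proof (rule bezoutian_eqI)
    show "B \<in> carrier_mat (total_degree p_G4) (total_degree p_G4)"
      by (simp add: B_def total_degree_p_G4)
  next
    fix x :: "real ^ 4" and t s :: real
    assume "t \<noteq> s"
    define F G where "F i = eval_rpoly (f i) x" and "G i = eval_rpoly (g i) x" for i
    have "(\<Sum>i\<le>4. F i * t ^ i) * (\<Sum>i\<le>4. G i * s ^ i) - (\<Sum>i\<le>4. G i * t ^ i) * (\<Sum>i\<le>4. F i * s ^ i)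
      = (t - s) * (\<Sum>i<4. \<Sum>j<4. (\<Sum>m\<le>min i (3 - j).
          F (j + m + 1) * G (i - m) - F (i - m) * G (j + m + 1)) * t ^ i * s ^ j)"
      by (simp add: eval_nat_numeral algebra_simps)
    with \<open>t \<noteq> s\<close> show "(eval_rpoly p_G4 (x + t *\<^sub>R e) * dir_deriv u p_G4 (x + s *\<^sub>R e)
        - dir_deriv u p_G4 (x + t *\<^sub>R e) * eval_rpoly p_G4 (x + s *\<^sub>R e)) / (t - s)
      = (\<Sum>i<total_degree p_G4. \<Sum>j<total_degree p_G4. eval_rpoly (B $$ (i, j)) x * t ^ i * s ^ j)"
      unfolding f g total_degree_p_G4 F_def G_def by (simp add: B_def eval_rpoly_sum)
  qed
  moreover have "f 1 * g 0 - f 0 * g 1 = bez_corner"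
  proof -
    have "eval_rpoly (f 1 * g 0 - f 0 * g 1 - bez_corner) x = 0" for x :: "real ^ 4"
    proof -
      obtain a b c d where x: "x = vector [a, b, c, d]"
        by (rule vector_4_exhaust)
      show ?thesis
        unfolding x eval_rpoly_diff eval_rpoly_mult eval_bez_corner bez_terms_def
        by (simp add: f_def g_def P_def N_def S_def M_def eval_p_G4)
           (simp add: power2_eq_square power3_eq_cube power4_eq_xxxx algebra_simps)
    qed
    then have "f 1 * g 0 - f 0 * g 1 - bez_corner = 0"
      by (rule rpoly_eq_0I)
    then show ?thesis
      by simp
  qed
  ultimately show "dim_row (bezoutian p_G4 e u) = 4" "bezoutian p_G4 e u $$ (0, 0) = bez_corner"
    by (simp_all add: B_def)
qed

section \<open>The upper left entry is not a sum of squares\<close>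

lemma lookup_sum_terms:
  "Poly_Mapping.lookup (\<Sum>(r, i, j, k, l)\<leftarrow>ts. Poly_Mapping.single (monom4 i j k l) r) m
    = (\<Sum>(r, i, j, k, l)\<leftarrow>ts. if monom4 i j k l = m then r else 0)"
  by (induction ts) (auto simp: lookup_add lookup_single when_def)

lemma keys_sum_terms:
  "Poly_Mapping.keys (\<Sum>(r, i, j, k, l)\<leftarrow>ts. Poly_Mapping.single (monom4 i j k l) r)
    \<subseteq> (\<lambda>(r, i, j, k, l). monom4 i j k l) ` set ts"
proof
  fix m
  assume "m \<in> Poly_Mapping.keys (\<Sum>(r, i, j, k, l)\<leftarrow>ts. Poly_Mapping.single (monom4 i j k l) r)"
  then have "(\<Sum>(r, i, j, k, l)\<leftarrow>ts. if monom4 i j k l = m then r else 0) \<noteq> 0"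
    by (simp add: in_keys_iff lookup_sum_terms)
  then show "m \<in> (\<lambda>(r, i, j, k, l). monom4 i j k l) ` set ts"
    by (induction ts) (auto split: if_splits)
qed

text \<open>
  Homogeneity and the shape of the Newton polytope of the sextic leave only eleven
  monomials for the summands of a decomposition into squares.
\<close>

lemma exponent_bounds:
  fixes q :: "nat \<Rightarrow> 4 rpoly"
  assumes sos: "bez_corner = (\<Sum>k<N. q k * q k)"
    and "k < N" "monom4 i1 i2 i3 i4 \<in> Poly_Mapping.keys (q k)"
  shows "i1 + i2 + i3 + i4 = 3" "i1 \<le> 2" "i2 \<le> 2" "i3 \<le> 2" "i4 \<le> 1" "i1 + i4 \<le> 2" "i2 + i4 \<le> 2"
proof -
  have bound: "w1 * int i1 + w2 * int i2 + w3 * int i3 + w4 * int i4 \<le> D"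
    if tab: "\<forall>(r, j1, j2, j3, j4) \<in> set bez_terms.
      w1 * int j1 + w2 * int j2 + w3 * int j3 + w4 * int j4 \<le> 2 * D" for w1 w2 w3 w4 D
  proof -
    define w :: "4 \<Rightarrow> int" where "w = (\<lambda>i. if i = 1 then w1 else if i = 2 then w2
      else if i = 3 then w3 else w4)"
    have w: "weight w (monom4 j1 j2 j3 j4)
        = w1 * int j1 + w2 * int j2 + w3 * int j3 + w4 * int j4" for j1 j2 j3 j4
      by (simp add: w_def)
    have le: "weight w m \<le> 2 * D" if "m \<in> Poly_Mapping.keys (\<Sum>k<N. q k * q k)" for m
    proof -
      have "m \<in> (\<lambda>(r, j1, j2, j3, j4). monom4 j1 j2 j3 j4) ` set bez_terms"
        using that keys_sum_terms[of bez_terms] unfolding sos[symmetric] bez_corner_def by blast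
      then obtain r j1 j2 j3 j4 where "(r, j1, j2, j3, j4) \<in> set bez_terms"
        and m: "m = monom4 j1 j2 j3 j4"
        by auto
      from bspec[OF tab this(1)] show ?thesis
        unfolding m w by simp
    qed
    have "weight w (monom4 i1 i2 i3 i4) \<le> D"
      using assms(2) by (intro weight_le_of_sum_squares[where q = q, OF finite_lessThan le _ assms(3)]) simp_all
    then show ?thesis
      unfolding w .
  qed
  have terms: "j1 + j2 + j3 + j4 = 6 \<and> j1 \<le> 4 \<and> j2 \<le> 4 \<and> j3 \<le> 4 \<and> j4 \<le> 2
      \<and> j1 + j4 \<le> 4 \<and> j2 + j4 \<le> 4" if "(r, j1, j2, j3, j4) \<in> set bez_terms" for r j1 j2 j3 j4
  proof -
    have "\<forall>(r, j1, j2, j3, j4) \<in> set bez_terms. j1 + j2 + j3 + j4 = 6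
        \<and> j1 \<le> 4 \<and> j2 \<le> 4 \<and> j3 \<le> 4 \<and> j4 \<le> 2 \<and> j1 + j4 \<le> 4 \<and> j2 + j4 \<le> 4"
      by (simp add: bez_terms_def)
    from bspec[OF this that] show ?thesis
      by simp
  qed
  have "1 * int i1 + 1 * int i2 + 1 * int i3 + 1 * int i4 \<le> 3"
    by (rule bound) (auto dest!: terms)
  moreover have "(- 1) * int i1 + (- 1) * int i2 + (- 1) * int i3 + (- 1) * int i4 \<le> - 3"
    by (rule bound) (auto dest!: terms)
  ultimately show "i1 + i2 + i3 + i4 = 3"
    by linarith
  have "1 * int i1 + 0 * int i2 + 0 * int i3 + 0 * int i4 \<le> 2"
    by (rule bound) (auto dest!: terms)
  then show "i1 \<le> 2"
    by simp
  have "0 * int i1 + 1 * int i2 + 0 * int i3 + 0 * int i4 \<le> 2"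
    by (rule bound) (auto dest!: terms)
  then show "i2 \<le> 2"
    by simp
  have "0 * int i1 + 0 * int i2 + 1 * int i3 + 0 * int i4 \<le> 2"
    by (rule bound) (auto dest!: terms)
  then show "i3 \<le> 2"
    by simp
  have "0 * int i1 + 0 * int i2 + 0 * int i3 + 1 * int i4 \<le> 1"
    by (rule bound) (auto dest!: terms)
  then show "i4 \<le> 1"
    by simp
  have "1 * int i1 + 0 * int i2 + 0 * int i3 + 1 * int i4 \<le> 2"
    by (rule bound) (auto dest!: terms)
  then show "i1 + i4 \<le> 2"
    by simp
  have "0 * int i1 + 1 * int i2 + 0 * int i3 + 1 * int i4 \<le> 2"
    by (rule bound) (auto dest!: terms)
  then show "i2 + i4 \<le> 2"
    by simp
qed

text \<open>
  The coefficients of one monomial in all the \<open>q k\<close> form a vector indexed by \<open>k\<close>, and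
  the coefficients of the sextic prescribe sums of inner products \<open>ip\<close> of these vectors.
  In the names, \<open>a, b, c, d\<close> stand for the four variables: the vector \<open>aab\<close> belongs to
  \<open>x\<^sub>1\<^sup>2 x\<^sub>2\<close>, and the equation \<open>a4b2\<close> compares the coefficients of \<open>x\<^sub>1^4 x\<^sub>2\<^sup>2\<close>.
\<close>

lemma bez_corner_not_sum_squares:
  fixes q :: "nat \<Rightarrow> 4 rpoly"
  assumes sos: "bez_corner = (\<Sum>k<N. q k * q k)"
  shows False
proof -
  define L where "L = [
    monom4 2 1 0 0, monom4 1 2 0 0, monom4 2 0 1 0, monom4 1 0 2 0,
    monom4 0 2 1 0, monom4 0 1 2 0, monom4 1 1 1 0, monom4 1 1 0 1,
    monom4 1 0 1 1, monom4 0 1 1 1, monom4 0 0 2 1]"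
  have keys: "Poly_Mapping.keys (q k) \<subseteq> set L" if "k < N" for k
  proof
    fix m assume m: "m \<in> Poly_Mapping.keys (q k)"
    obtain i1 i2 i3 i4 where m_eq: "m = monom4 i1 i2 i3 i4"
      using monom4_lookup by blast
    note b = exponent_bounds[OF sos that m[unfolded m_eq]]
    have "i1 = 0 \<or> i1 = 1 \<or> i1 = 2" "i2 = 0 \<or> i2 = 1 \<or> i2 = 2" "i4 = 0 \<or> i4 = 1"
      "i3 = 3 - i1 - i2 - i4"
      using b by linarith+
    then show "m \<in> set L"
      using b unfolding m_eq L_def by (elim disjE) simp_all
  qed
  have "distinct L"
    by (simp add: L_def)
  have coeff: "(\<Sum>k<N. \<Sum>m\<leftarrow>L. \<Sum>n\<leftarrow>L.
        if m + n = l then Poly_Mapping.lookup (q k) m * Poly_Mapping.lookup (q k) n else 0)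
      = (\<Sum>(r, i1, i2, i3, i4)\<leftarrow>bez_terms. if monom4 i1 i2 i3 i4 = l then r else 0)" for l
  proof -
    have "Poly_Mapping.lookup bez_corner l = (\<Sum>k<N. Poly_Mapping.lookup (q k * q k) l)"
      unfolding sos by (rule lookup_sum)
    also have "\<dots> = (\<Sum>k<N. \<Sum>m\<leftarrow>L. \<Sum>n\<leftarrow>L.
        if m + n = l then Poly_Mapping.lookup (q k) m * Poly_Mapping.lookup (q k) n else 0)"
      by (intro sum.cong refl, subst lookup_mult_eq_sum[of "set L" _ "set L"])
         (use keys \<open>distinct L\<close> in \<open>auto simp: sum_list_distinct_conv_sum_set\<close>)
    finally show ?thesis
      unfolding bez_corner_def lookup_sum_terms ..
  qed
  define aab and abb and aac and acc and bbc and bcc and abc and abd and acd and bcd and ccd where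
    "aab k = Poly_Mapping.lookup (q k) (monom4 2 1 0 0)"
    and "abb k = Poly_Mapping.lookup (q k) (monom4 1 2 0 0)"
    and "aac k = Poly_Mapping.lookup (q k) (monom4 2 0 1 0)"
    and "acc k = Poly_Mapping.lookup (q k) (monom4 1 0 2 0)"
    and "bbc k = Poly_Mapping.lookup (q k) (monom4 0 2 1 0)"
    and "bcc k = Poly_Mapping.lookup (q k) (monom4 0 1 2 0)"
    and "abc k = Poly_Mapping.lookup (q k) (monom4 1 1 1 0)"
    and "abd k = Poly_Mapping.lookup (q k) (monom4 1 1 0 1)"
    and "acd k = Poly_Mapping.lookup (q k) (monom4 1 0 1 1)"
    and "bcd k = Poly_Mapping.lookup (q k) (monom4 0 1 1 1)"
    and "ccd k = Poly_Mapping.lookup (q k) (monom4 0 0 2 1)"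
    for k
  define ip where "ip f g = (\<Sum>k<N. f k * g k)" for f g :: "nat \<Rightarrow> real"
  note ip_expand = ip_def sum.distrib mult.commute aab_def abb_def aac_def acc_def bbc_def
    bcc_def abc_def abd_def acd_def bcd_def ccd_def
  have a4b2: "ip aab aab = 32"
    using coeff[of "monom4 4 2 0 0"]
    by (simp add: L_def bez_terms_def ip_expand flip: sum_distrib_left)
  have a3b3: "2 * ip aab abb = 64"
    using coeff[of "monom4 3 3 0 0"]
    by (simp add: L_def bez_terms_def ip_expand flip: sum_distrib_left)
  have a2b4: "ip abb abb = 32"
    using coeff[of "monom4 2 4 0 0"]
    by (simp add: L_def bez_terms_def ip_expand flip: sum_distrib_left)
  have a4c2: "ip aac aac = 16"
    using coeff[of "monom4 4 0 2 0"]
    by (simp add: L_def bez_terms_def ip_expand flip: sum_distrib_left)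
  have a3c3: "2 * ip aac acc = 32"
    using coeff[of "monom4 3 0 3 0"]
    by (simp add: L_def bez_terms_def ip_expand flip: sum_distrib_left)
  have a2c4: "ip acc acc = 16"
    using coeff[of "monom4 2 0 4 0"]
    by (simp add: L_def bez_terms_def ip_expand flip: sum_distrib_left)
  have b4c2: "ip bbc bbc = 16"
    using coeff[of "monom4 0 4 2 0"]
    by (simp add: L_def bez_terms_def ip_expand flip: sum_distrib_left)
  have b3c3: "2 * ip bbc bcc = 32"
    using coeff[of "monom4 0 3 3 0"]
    by (simp add: L_def bez_terms_def ip_expand flip: sum_distrib_left)
  have b2c4: "ip bcc bcc = 16"
    using coeff[of "monom4 0 2 4 0"]
    by (simp add: L_def bez_terms_def ip_expand flip: sum_distrib_left)
  have a4bc: "2 * ip aab aac = 32"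
    using coeff[of "monom4 4 1 1 0"]
    by (simp add: L_def bez_terms_def ip_expand flip: sum_distrib_left)
  have ab4c: "2 * ip abb bbc = 32"
    using coeff[of "monom4 1 4 1 0"]
    by (simp add: L_def bez_terms_def ip_expand flip: sum_distrib_left)
  have a3b2c: "2 * ip aab abc + 2 * ip abb aac = 160"
    using coeff[of "monom4 3 2 1 0"]
    by (simp add: L_def bez_terms_def ip_expand flip: sum_distrib_left)
  have a2b3c: "2 * ip aab bbc + 2 * ip abb abc = 160"
    using coeff[of "monom4 2 3 1 0"]
    by (simp add: L_def bez_terms_def ip_expand flip: sum_distrib_left)
  have a3b2d: "2 * ip aab abd = 64"
    using coeff[of "monom4 3 2 0 1"]
    by (simp add: L_def bez_terms_def ip_expand flip: sum_distrib_left)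
  have a3bc2: "2 * ip aab acc + 2 * ip aac abc = 128"
    using coeff[of "monom4 3 1 2 0"]
    by (simp add: L_def bez_terms_def ip_expand flip: sum_distrib_left)
  have ab3c2: "2 * ip abb bcc + 2 * ip bbc abc = 128"
    using coeff[of "monom4 1 3 2 0"]
    by (simp add: L_def bez_terms_def ip_expand flip: sum_distrib_left)
  have abc4: "2 * ip acc bcc = 24"
    using coeff[of "monom4 1 1 4 0"]
    by (simp add: L_def bez_terms_def ip_expand flip: sum_distrib_left)
  have a2b2c2: "2 * ip aab bcc + 2 * ip abb acc + 2 * ip aac bbc + ip abc abc = 288"
    using coeff[of "monom4 2 2 2 0"]
    by (simp add: L_def bez_terms_def ip_expand flip: sum_distrib_left)
  have a3bcd: "2 * ip aab acd + 2 * ip aac abd = 64"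
    using coeff[of "monom4 3 1 1 1"]
    by (simp add: L_def bez_terms_def ip_expand flip: sum_distrib_left)
  have ab3cd: "2 * ip abb bcd + 2 * ip bbc abd = 64"
    using coeff[of "monom4 1 3 1 1"]
    by (simp add: L_def bez_terms_def ip_expand flip: sum_distrib_left)
  have a2bc2d: "2 * ip aab ccd + 2 * ip aac bcd + 2 * ip acc abd + 2 * ip abc acd = 224"
    using coeff[of "monom4 2 1 2 1"]
    by (simp add: L_def bez_terms_def ip_expand flip: sum_distrib_left)
  have ab2c2d: "2 * ip abb ccd + 2 * ip bbc acd + 2 * ip bcc abd + 2 * ip abc bcd = 224"
    using coeff[of "monom4 1 2 2 1"]
    by (simp add: L_def bez_terms_def ip_expand flip: sum_distrib_left)
  have a3c2d: "2 * ip aac acd = 32"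
    using coeff[of "monom4 3 0 2 1"]
    by (simp add: L_def bez_terms_def ip_expand flip: sum_distrib_left)
  have b3c2d: "2 * ip bbc bcd = 32"
    using coeff[of "monom4 0 3 2 1"]
    by (simp add: L_def bez_terms_def ip_expand flip: sum_distrib_left)
  have ac4d: "2 * ip acc ccd = 8"
    using coeff[of "monom4 1 0 4 1"]
    by (simp add: L_def bez_terms_def ip_expand flip: sum_distrib_left)
  have bc4d: "2 * ip bcc ccd = 8"
    using coeff[of "monom4 0 1 4 1"]
    by (simp add: L_def bez_terms_def ip_expand flip: sum_distrib_left)
  have a2b2cd: "2 * ip aab bcd + 2 * ip abb acd + 2 * ip abc abd = 256"
    using coeff[of "monom4 2 2 1 1"]
    by (simp add: L_def bez_terms_def ip_expand flip: sum_distrib_left)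
  have a2b2d2: "ip abd abd = 64"
    using coeff[of "monom4 2 2 0 2"]
    by (simp add: L_def bez_terms_def ip_expand flip: sum_distrib_left)
  have a2bcd2: "2 * ip abd acd = 88"
    using coeff[of "monom4 2 1 1 2"]
    by (simp add: L_def bez_terms_def ip_expand flip: sum_distrib_left)
  have ab2cd2: "2 * ip abd bcd = 88"
    using coeff[of "monom4 1 2 1 2"]
    by (simp add: L_def bez_terms_def ip_expand flip: sum_distrib_left)
  have a2c2d2: "ip acd acd = 44"
    using coeff[of "monom4 2 0 2 2"]
    by (simp add: L_def bez_terms_def ip_expand flip: sum_distrib_left)
  have b2c2d2: "ip bcd bcd = 44"
    using coeff[of "monom4 0 2 2 2"]
    by (simp add: L_def bez_terms_def ip_expand flip: sum_distrib_left)
  have abc2d2: "2 * ip abd ccd + 2 * ip acd bcd = 96"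
    using coeff[of "monom4 1 1 2 2"]
    by (simp add: L_def bez_terms_def ip_expand flip: sum_distrib_left)
  have ac3d2: "2 * ip acd ccd = 16"
    using coeff[of "monom4 1 0 3 2"]
    by (simp add: L_def bez_terms_def ip_expand flip: sum_distrib_left)
  have bc3d2: "2 * ip bcd ccd = 16"
    using coeff[of "monom4 0 1 3 2"]
    by (simp add: L_def bez_terms_def ip_expand flip: sum_distrib_left)
  have abc3d: "2 * ip acc bcd + 2 * ip bcc acd + 2 * ip abc ccd = 96"
    using coeff[of "monom4 1 1 3 1"]
    by (simp add: L_def bez_terms_def ip_expand flip: sum_distrib_left)
  have c4d2: "ip ccd ccd = 2"
    using coeff[of "monom4 0 0 4 2"]
    by (simp add: L_def bez_terms_def ip_expand flip: sum_distrib_left)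
  have identify: "ip h g = ip h f" "ip g h = ip f h" if "ip f f - 2 * ip f g + ip g g = 0"
    for f g h :: "nat \<Rightarrow> real"
  proof -
    have "(\<Sum>k<N. (f k - g k)\<^sup>2) = 0"
      using that
      by (simp add: ip_def power2_eq_square algebra_simps sum.distrib sum_subtractf sum_distrib_left)
    then have "f k = g k" if "k < N" for k
      using that by (simp add: sum_nonneg_eq_0_iff)
    then show "ip h g = ip h f" "ip g h = ip f h"
      by (simp_all add: ip_def)
  qed
  \<comment> \<open>The sextic has the edges \<open>32 (a\<^sup>2 b + a b\<^sup>2)\<^sup>2\<close>, \<open>16 (a\<^sup>2 c + a c\<^sup>2)\<^sup>2\<close> and
    \<open>16 (b\<^sup>2 c + b c\<^sup>2)\<^sup>2\<close>, so in each of these three pairs of monomials both vectors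
    have the same norm, whose square is also their inner product; hence the two vectors
    coincide.\<close>
  have ab: "ip aab aab - 2 * ip aab abb + ip abb abb = 0"
    and ac: "ip aac aac - 2 * ip aac acc + ip acc acc = 0"
    and bc: "ip bbc bbc - 2 * ip bbc bcc + ip bcc bcc = 0"
    using a4b2 a3b3 a2b4 a4c2 a3c3 a2c4 b4c2 b3c3 b2c4 by linarith+
  note same = identify[OF ab] identify[OF ac] identify[OF bc]
  \<comment> \<open>These two combinations are a rational solution of the dual semidefinite program: in
    \<open>324 |v|\<^sup>2 + |w|\<^sup>2\<close>, the inner products occur only in combinations that the
    coefficients of the sextic prescribe.\<close>
  define v where "v k = - 2 * aab k + 2 * aac k + 2 * bbc k - abc k + 3 * abd k - acd k - bcd k" for k
  define w where "w k = 11 * aab k + 15 * aac k + 15 * bbc k - 21 * abc k + 10 * abd k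
    + 6 * acd k + 6 * bcd k + 36 * ccd k" for k
  have "0 \<le> (\<Sum>k<N. 324 * (v k * v k) + w k * w k)"
    by (intro sum_nonneg) simp
  also have "\<dots> = - 352"
  proof -
    note gram = a4b2 a3b3 a2b4 a4c2 a3c3 a2c4 b4c2 b3c3 b2c4 a4bc ab4c a3b2c a2b3c a3b2d a3bc2 ab3c2
      abc4 a2b2c2 a3bcd ab3cd a2bc2d ab2c2d a3c2d b3c2d ac4d bc4d a2b2cd a2b2d2
      a2bcd2 ab2cd2 a2c2d2 b2c2d2 abc2d2 ac3d2 bc3d2 abc3d c4d2
    from gram[unfolded same, unfolded ip_def] show ?thesis
      unfolding v_def w_def
      by (simp add: algebra_simps sum.distrib sum_subtractf)
         (simp only: mult.assoc[symmetric] sum_distrib_right[symmetric])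
  qed
  finally show False
    by simp
qed

section \<open>Hyperbolicity and the failure of the sum-of-squares property\<close>

lemma matrix_sos_diagonal:
  assumes "matrix_sos B" "i < dim_row B"
  obtains N q where "B $$ (i, i) = (\<Sum>k<(N::nat). q k * q k)"
proof -
  obtain N Q where Q: "Q \<in> carrier_mat (dim_row B) N" "B = Q * transpose_mat Q"
    using assms(1) unfolding matrix_sos_def by blast
  have "B $$ (i, i) = (\<Sum>k<N. Q $$ (i, k) * Q $$ (i, k))"
    using carrier_matD[OF Q(1)] assms(2)
    by (subst Q(2)) (simp add: scalar_prod_def atLeast0LessThan)
  then show thesis
    by (rule that)
qed

lemma cvec_vector_4:
  "cvec (vector [a, b, c, d] :: real ^ 4)
    = vector [of_real a, of_real b, of_real c, of_real d]"
  by (simp add: cvec_def Finite_Cartesian_Product.vec_eq_iff forall_4)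

lemma vector_4_smult:
  "z *s (vector [a, b, c, d] :: 'a::comm_ring_1 ^ 4) = vector [z * a, z * b, z * c, z * d]"
  by (simp add: Finite_Cartesian_Product.vec_eq_iff forall_4)

lemma vector_4_diff:
  "(vector [a, b, c, d] :: 'a::group_add ^ 4) - vector [a', b', c', d']
    = vector [a - a', b - b', c - c', d - d']"
  by (simp add: Finite_Cartesian_Product.vec_eq_iff forall_4)

lemma hyperbolic_p_G4: "hyperbolic p_G4 (vector [0, 0, 1, 1])"
  unfolding hyperbolic_def
proof (intro conjI allI impI)
  show "homogeneous p_G4"
    using form_p_G4 unfolding homogeneous_def total_degree_p_G4 form_def .
  show "eval_rpoly p_G4 (vector [0, 0, 1, 1] :: real ^ 4) > 0"
    by (simp add: eval_p_G4)
next
  fix x :: "real ^ 4" and z :: complex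
  assume root: "eval_rpoly p_G4 (cvec x + z *s cvec (vector [0, 0, 1, 1])) = 0"
  obtain a b c d where x: "x = vector [a, b, c, d]"
    by (rule vector_4_exhaust)
  define h k where "h = (c + d) / 2" and "k = (c - d) / 2"
  have cd: "c = h + k" "d = h - k"
    by (simp_all add: h_def k_def field_simps)
  define P N where "P = a + b" and "N = a * b"
  define y where "y = z + of_real h"
  have "4 * N \<le> P\<^sup>2"
    using zero_le_power2[of "a - b"] by (simp add: P_def N_def power2_eq_square algebra_simps)
  moreover have "y^4 + of_real (8 * P) * y^3 + of_real (4 * P\<^sup>2 + 16 * N - 2 * k\<^sup>2) * y\<^sup>2
      + of_real (8 * N * P - 8 * P * k\<^sup>2) * y + of_real (k^4 - 4 * P\<^sup>2 * k\<^sup>2) = 0"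
  proof -
    have "eval_rpoly p_G4 (vector [of_real a, of_real b, y + of_real k, y - of_real k])
      = y^4 + of_real (8 * P) * y^3 + of_real (4 * P\<^sup>2 + 16 * N - 2 * k\<^sup>2) * y\<^sup>2
      + of_real (8 * N * P - 8 * P * k\<^sup>2) * y + of_real (k^4 - 4 * P\<^sup>2 * k\<^sup>2)"
      unfolding eval_p_G4 P_def N_def
      by (simp add: power2_eq_square power3_eq_cube power4_eq_xxxx algebra_simps)
    moreover have "cvec x + z *s cvec (vector [0, 0, 1, 1])
        = vector [of_real a, of_real b, y + of_real k, y - of_real k]"
      unfolding x cvec_vector_4 vector_4_smult vector_4_add
      by (simp add: y_def cd algebra_simps)
    ultimately show ?thesis
      using root by simp
  qed
  ultimately have "y \<in> \<real>"
    by (rule p_G4_quartic_roots_real)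
  then have "y - of_real h \<in> \<real>"
    by simp
  then show "z \<in> \<real>"
    by (simp add: y_def)
qed

lemma in_hyperbolicity_cone_p_G4:
  "vector [0, 0, 0, 1] \<in> hyperbolicity_cone p_G4 (vector [0, 0, 1, 1])"
  unfolding hyperbolicity_cone_def
proof (intro CollectI allI impI)
  fix z :: complex
  assume "eval_rpoly p_G4 (z *s cvec (vector [0, 0, 1, 1]) - cvec (vector [0, 0, 0, 1])) = 0"
  then have "z = 0 \<or> z = 1"
    unfolding cvec_vector_4 vector_4_smult vector_4_diff eval_p_G4 by simp
  then show "z \<in> \<real> \<and> Re z \<ge> 0"
    by auto
qed

theorem proposition4p9:
  fixes e u :: "real ^ 4"
  defines "e \<equiv> vector [0, 0, 1, 1]"
    and "u \<equiv> vector [0, 0, 0, 1]"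
  shows "hyperbolic p_G4 e \<and> u \<in> hyperbolicity_cone p_G4 e \<and> \<not> matrix_sos (bezoutian p_G4 e u)"
proof (intro conjI notI)
  assume sos: "matrix_sos (bezoutian p_G4 e u)"
  have "0 < dim_row (bezoutian p_G4 e u)"
    using bezoutian_p_G4_corner(1) by (simp add: e_def u_def)
  with sos obtain N q where "bezoutian p_G4 e u $$ (0, 0) = (\<Sum>k<(N::nat). q k * q k)"
    by (rule matrix_sos_diagonal)
  then show False
    using bez_corner_not_sum_squares bezoutian_p_G4_corner(2) unfolding e_def u_def by metis
qed (use hyperbolic_p_G4 in_hyperbolicity_cone_p_G4 in \<open>simp_all add: e_def u_def\<close>)

end
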